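(* Let $\mathcal{M}_r,\mathcal{M}_s\in\mathbb{R}^{n\times n}$ be the (constant, symmetric positive-definite) Cartesian inertia matrices of the emulating and target robots, and let $\mathcal{Q}=\mathcal{M}_s\mathcal{M}_r^{-1}$. Let $G_v>0$, $G_p>0$ be the gains of the control law, with controller bandwidth $\omega_p=2G_p/G_v$, and let $\omega_a>0$ be the bandwidth of the emulating robot's actuators. If $\mathcal{Q}$ is positive definite (i.e. all its eigenvalues are positive) and its maximum eigenvalue satisfies $$\lambda_{\max}(\mathcal{Q})<\frac{2\omega_a}{\omega_p},$$ then the emulating robot establishes a stable contact, i.e. the contact-phase closed loop $$f_a=-L(s)(f_a-\lambda),\qquad L(s)=\mathcal{Q}^{-1}L'(s),\qquad L'(s)=\frac{s^2+G_vs+G_p}{\omega_a^{-1}s^3},$$ is stable: its closed-loop transfer matrix from $\lambda$ to $f_a$, $T(s)=[I+L(s)]^{-1}L(s)=[\mathcal{Q}+L'(s)I]^{-1}L'(s)$, has all its poles in the open left half-plane.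
   Context: Setting: an emulating robot (subscript $r$, $n$ degrees of freedom) in full contact with its environment is driven so as to emulate a target robot (subscript $s$) run in a simulator. For each robot the Cartesian inertia matrix is $\mathcal{M}=[JM^{-1}J^T]^{-1}$, with $M$ the joint-space inertia matrix and $J$ the end-effector Jacobian. In the contact phase velocities and accelerations are negligible, so $M$, $J$ and $\mathcal{M}$ are treated as constant and a Laplace-domain analysis is used. $f_a$ is the physical contact force and $\lambda$ is the Lagrange multiplier (simulated contact force) of the target robot. The commanded torque $\tau_r^c$ reduces in contact to $\tau_r^c=-J_r^Tf_a+M_rJ_r^{-1}u$ with $u=Z(s)^{-1}\mathcal{M}_s^{-1}(f_a-\lambda)$, where $Z(s)=\dfrac{s^2}{s^2+G_vs+G_p}$ and $G_v,G_p$ are scalar gains. The actuators deliver $\tau_r=H(s)\tau_r^c$ with first-order dynamics $H(s)=\dfrac{1}{1+\omega_a^{-1}s}$, and in contact $f_a=-J_r^{-T}\tau_r$. Eliminating the torques gives the closed loop $f_a=-L(s)(f_a-\lambda)$ with $L(s)=\mathcal{Q}^{-1}L'(s)$ and $L'(s)=\dfrac{H(s)}{Z(s)-Z(s)H(s)}=\dfrac{s^2+G_vs+G_p}{\omega_a^{-1}s^3}$. *)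

theory Defs
  imports "HOL-Complex_Analysis.Complex_Analysis"
begin

definition sym_pos_def :: "real^'n^'n \<Rightarrow> bool" where
  "sym_pos_def A \<longleftrightarrow> transpose A = A \<and> (\<forall>x. x \<noteq> 0 \<longrightarrow> 0 < x \<bullet> (A *v x))"

abbreviation cmatrix :: "real^'n^'m \<Rightarrow> complex^'n^'m" where
  "cmatrix A \<equiv> map_matrix complex_of_real A"

text \<open>A product such as \<open>\<Q> = \<M>\<^sub>s \<M>\<^sub>r\<^sup>-\<^sup>1\<close> is in general not symmetric, so the eigenvalues of a
  real matrix are taken over the complex numbers and positivity is a condition on all of them.\<close>

definition eigenvalues :: "real^'n^'n \<Rightarrow> complex set" where
  "eigenvalues A = {\<mu>. \<exists>v. v \<noteq> 0 \<and> cmatrix A *v v = \<mu> *s v}"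

definition all_eigenvalues_positive :: "real^'n^'n \<Rightarrow> bool" where
  "all_eigenvalues_positive A \<longleftrightarrow> (\<forall>\<mu>\<in>eigenvalues A. \<mu> \<in> \<real> \<and> 0 < Re \<mu>)"

definition max_eigenvalue :: "real^'n^'n \<Rightarrow> real" where
  "max_eigenvalue A = Max {x. complex_of_real x \<in> eigenvalues A}"

definition loop_scalar :: "real \<Rightarrow> real \<Rightarrow> real \<Rightarrow> complex \<Rightarrow> complex" where
  "loop_scalar G_v G_p \<omega>_a s =
     (s^2 + complex_of_real G_v * s + complex_of_real G_p)
       / (inverse (complex_of_real \<omega>_a) * s^3)"

text \<open>In the next two definitions \<^term>\<open>mat c\<close> is the scalar matrix \<open>c I\<close>.\<close>

definition loop_gain :: "real^'n^'n \<Rightarrow> (complex \<Rightarrow> complex) \<Rightarrow> complex \<Rightarrow> complex^'n^'n" where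
  "loop_gain Q L' s = matrix_inv (cmatrix Q) ** mat (L' s)"

definition closed_loop :: "(complex \<Rightarrow> complex^'n^'n) \<Rightarrow> complex \<Rightarrow> complex^'n^'n" where
  "closed_loop L s = matrix_inv (mat 1 + L s) ** L s"

text \<open>The poles of a transfer matrix are those of its entries. Since \<^const>\<open>is_pole\<close> only looks at
  punctured neighbourhoods, the values at isolated points where a formula divides by zero or
  inverts a singular matrix are irrelevant.\<close>

definition poles :: "(complex \<Rightarrow> complex^'n^'m) \<Rightarrow> complex set" where
  "poles T = {p. \<exists>i j. is_pole (\<lambda>s. T s $ i $ j) p}"

definition stable_transfer :: "(complex \<Rightarrow> complex^'n^'m) \<Rightarrow> bool" where
  "stable_transfer T \<longleftrightarrow> (\<forall>p\<in>poles T. Re p < 0)"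

end

theory Submission
  imports Defs
begin

text \<open>The matrix \<open>\<Q> + c I\<close> is singular exactly if \<open>-c\<close> is an eigenvalue of \<open>\<Q>\<close>, so the loop is
  singular at \<open>s\<close> exactly if \<open>(\<mu> / \<omega>\<^sub>a) s\<^sup>3 + s\<^sup>2 + G\<^sub>v s + G\<^sub>p = 0\<close> for some eigenvalue \<open>\<mu>\<close>. Since
  \<open>\<mu>\<close> is real and positive, the Routh-Hurwitz criterion puts the roots of this cubic in the open left
  half-plane as soon as \<open>\<mu> G\<^sub>p < \<omega>\<^sub>a G\<^sub>v\<close>, which is the bound on \<open>\<lambda>\<^sub>m\<^sub>a\<^sub>x(\<Q>)\<close>. Clearing the
  denominator \<open>\<omega>\<^sub>a\<^sup>-\<^sup>1 s\<^sup>3\<close> shows that the origin, a pole of \<open>L\<close>, is not a pole of the closed loop.\<close>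

section \<open>Routh-Hurwitz criterion for a real cubic\<close>

lemma cubic_hurwitz:
  fixes a b c :: real and s :: complex
  assumes "0 < a" "0 < b" "0 < c" and stable: "a * c < b"
    and root: "complex_of_real a * s ^ 3 + s ^ 2 + complex_of_real b * s + complex_of_real c = 0"
  shows "Re s < 0"
proof (rule ccontr)
  define x y where "x = Re s" and "y = Im s"
  assume "\<not> Re s < 0"
  then have x: "0 \<le> x" by (simp add: x_def)
  have s: "s = Complex x y" by (simp add: x_def y_def)
  have re: "a * (x ^ 3 - 3 * x * y\<^sup>2) + (x\<^sup>2 - y\<^sup>2) + b * x + c = 0"
    using arg_cong[OF root, of Re] by (simp add: s power2_eq_square power3_eq_cube algebra_simps)
  have im: "y * (a * (3 * x\<^sup>2 - y\<^sup>2) + 2 * x + b) = 0"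
    using arg_cong[OF root, of Im] by (simp add: s power2_eq_square power3_eq_cube algebra_simps)
  show False
  proof (cases "y = 0")
    case True
    have "0 \<le> a * x ^ 3" "0 \<le> b * x" using x assms by simp_all
    then show ?thesis using re True \<open>0 < c\<close> zero_le_power2[of x] by simp
  next
    case False
    then have y: "a * y\<^sup>2 = 3 * (a * x\<^sup>2) + 2 * x + b" using im by (simp add: right_diff_distrib)
    \<comment> \<open>The factor \<open>a\<close> makes the square of \<open>y\<close> occur only in
      the product that the imaginary part has just expressed through \<open>x\<close>. After
      elimination every term is nonnegative for \<open>x\<close> \<ge> 0, and
      \<open>b - a * c\<close> is strictly positive.\<close>
    have "a * (a * (x ^ 3 - 3 * x * y\<^sup>2) + (x\<^sup>2 - y\<^sup>2) + b * x + c)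
        = a\<^sup>2 * x ^ 3 - 3 * a * x * (a * y\<^sup>2) + a * x\<^sup>2 - a * y\<^sup>2 + a * b * x + a * c"
      by (simp add: power2_eq_square power3_eq_cube algebra_simps)
    also have "\<dots> = - (8 * a\<^sup>2 * x ^ 3 + 8 * a * x\<^sup>2 + 2 * a * b * x + 2 * x + (b - a * c))"
      unfolding y by (simp add: power2_eq_square power3_eq_cube algebra_simps)
    finally have "8 * a\<^sup>2 * x ^ 3 + 8 * a * x\<^sup>2 + 2 * a * b * x + 2 * x + (b - a * c) = 0"
      using re by simp
    moreover have "0 \<le> 8 * a\<^sup>2 * x ^ 3" "0 \<le> 8 * a * x\<^sup>2" "0 \<le> 2 * a * b * x"
      using x assms by simp_all
    ultimately show ?thesis using x stable by linarith
  qed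
qed

section \<open>Scalar matrices, inverses and determinants\<close>

lemma mat_mult_component:
  fixes A :: "'a::semiring_1^'m^'n"
  shows "(mat c ** A) $ i $ j = c * A $ i $ j"
  by (simp add: matrix_matrix_mult_def mat_def if_distrib if_distribR cong: if_cong)

lemma mat_vector_mult:
  fixes v :: "'a::semiring_1^'n"
  shows "mat c *v v = c *s v"
  by (simp add: vec_eq_iff matrix_vector_mult_def mat_def if_distrib if_distribR cong: if_cong)

lemma invertible_iff_ker:
  fixes A :: "'a::field^'n^'n"
  shows "invertible A \<longleftrightarrow> (\<forall>v. A *v v = 0 \<longrightarrow> v = 0)"
  by (simp add: invertible_left_inverse matrix_left_invertible_ker)

lemma matrix_inv_mult:
  fixes A :: "'a::semiring_1^'n^'m"
  assumes "invertible A"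
  shows "A ** matrix_inv A = mat 1" "matrix_inv A ** A = mat 1"
proof -
  have "A ** matrix_inv A = mat 1 \<and> matrix_inv A ** A = mat 1"
    using assms unfolding invertible_def matrix_inv_def by (rule someI_ex)
  then show "A ** matrix_inv A = mat 1" "matrix_inv A ** A = mat 1" by simp_all
qed

lemma matrix_inv_vector_eq_iff:
  fixes A :: "'a::semiring_1^'n^'m"
  assumes "invertible A"
  shows "x = matrix_inv A *v b \<longleftrightarrow> A *v x = b"
  by (metis assms matrix_inv_mult matrix_vector_mul_assoc matrix_vector_mul_lid)

lemma isCont_det:
  fixes A :: "'a::t2_space \<Rightarrow> 'b::real_normed_field^'n^'n"
  assumes "\<And>i j. isCont (\<lambda>s. A s $ i $ j) q"
  shows "isCont (\<lambda>s. det (A s)) q"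
  unfolding det_def by (intro continuous_intros assms)

section \<open>Eigenvalues of a matrix\<close>

lemma eigenvectors_scalars_zero:
  fixes A :: "'a::field^'n^'n"
  assumes "finite F" and "\<And>\<mu>. \<mu> \<in> F \<Longrightarrow> v \<mu> \<noteq> 0 \<and> A *v v \<mu> = \<mu> *s v \<mu>"
    and "(\<Sum>\<mu>\<in>F. c \<mu> *s v \<mu>) = 0"
  shows "\<forall>\<mu>\<in>F. c \<mu> = 0"
  using assms
proof (induction F arbitrary: c)
  case empty
  then show ?case by simp
next
  case (insert \<nu> F)
  \<comment> \<open>Apply \<open>A\<close> minus \<nu> times the identity to the vanishing sum: the
    \<nu> term drops out, and every other term gains the factor \<mu> - \<nu>, nonzero because \<nu>
    is not in \<open>F\<close>.\<close>
  have "0 = A *v (\<Sum>\<mu>\<in>insert \<nu> F. c \<mu> *s v \<mu>) - \<nu> *s (\<Sum>\<mu>\<in>insert \<nu> F. c \<mu> *s v \<mu>)"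
    using insert.prems(2) by simp
  also have "\<dots> = (\<Sum>\<mu>\<in>insert \<nu> F. c \<mu> *s (A *v v \<mu>) - \<nu> *s (c \<mu> *s v \<mu>))"
    by (simp only: vec.linear_sum[OF matrix_vector_mul_linear_gen] vec.scale_sum_right
        vector_scalar_commute sum_subtractf)
  also have "\<dots> = (\<Sum>\<mu>\<in>insert \<nu> F. (c \<mu> * (\<mu> - \<nu>)) *s v \<mu>)"
    using insert.prems(1) by (intro sum.cong) (simp_all add: vec_eq_iff algebra_simps)
  also have "\<dots> = (\<Sum>\<mu>\<in>F. (c \<mu> * (\<mu> - \<nu>)) *s v \<mu>)"
    using insert.hyps by simp
  finally have "(\<Sum>\<mu>\<in>F. (c \<mu> * (\<mu> - \<nu>)) *s v \<mu>) = 0"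
    by (rule sym)
  then have "\<forall>\<mu>\<in>F. c \<mu> * (\<mu> - \<nu>) = 0"
    by (intro insert.IH[OF insert.prems(1)]) simp_all
  then have F: "\<forall>\<mu>\<in>F. c \<mu> = 0"
    using insert.hyps by auto
  then have "c \<nu> *s v \<nu> = 0"
    using insert.prems(2) insert.hyps by simp
  then show ?case
    using F insert.prems(1) by (simp add: vec.scale_eq_0_iff)
qed

text \<open>Choose one eigenvector per eigenvalue. The choice is injective, since a nonzero vector
  determines its eigenvalue, and its image is linearly independent, hence finite in finite
  dimension.\<close>

lemma finite_eigenvalues: "finite (eigenvalues A)"
proof -
  have "\<forall>\<mu>\<in>eigenvalues A. \<exists>v. v \<noteq> 0 \<and> cmatrix A *v v = \<mu> *s v"
    by (simp add: eigenvalues_def)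
  then obtain v where v: "\<And>\<mu>. \<mu> \<in> eigenvalues A \<Longrightarrow> v \<mu> \<noteq> 0 \<and> cmatrix A *v v \<mu> = \<mu> *s v \<mu>"
    using bchoice by metis
  have inj: "inj_on v (eigenvalues A)"
    by (rule inj_onI) (metis v vec.scale_cancel_right)
  have "vec.independent (v ` eigenvalues A)"
    unfolding vec.independent_explicit_finite_subsets
  proof (intro allI impI ballI)
    fix S u w
    assume S: "S \<subseteq> v ` eigenvalues A" "finite S" "(\<Sum>x\<in>S. u x *s x) = 0" "w \<in> S"
    obtain F where F: "F \<subseteq> eigenvalues A" "finite F" "S = v ` F"
      using finite_subset_image[OF S(2,1)] by blast
    have "(\<Sum>\<mu>\<in>F. u (v \<mu>) *s v \<mu>) = 0"
      using S(3) F by (simp add: sum.reindex inj_on_subset[OF inj])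
    then have "\<forall>\<mu>\<in>F. u (v \<mu>) = 0"
      using v F by (intro eigenvectors_scalars_zero[of F v "cmatrix A" "\<lambda>\<mu>. u (v \<mu>)"]) auto
    then show "u w = 0" using F S(4) by blast
  qed
  then show ?thesis
    using inj vec.finiteI_independent finite_imageD by blast
qed

lemma not_invertible_add_mat_iff:
  "\<not> invertible (cmatrix A + mat c) \<longleftrightarrow> - c \<in> eigenvalues A"
proof -
  have "(cmatrix A + mat c) *v v = 0 \<longleftrightarrow> cmatrix A *v v = (- c) *s v" for v
    by (simp add: matrix_vector_mult_add_rdistrib mat_vector_mult eq_neg_iff_add_eq_0)
  then show ?thesis
    unfolding invertible_iff_ker eigenvalues_def by auto
qed

text \<open>Finiteness of the spectrum makes the \<open>Max\<close> in \<open>max_eigenvalue\<close>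
  a genuine upper bound.\<close>

lemma eigenvalue_le_max_eigenvalue:
  assumes "complex_of_real x \<in> eigenvalues A"
  shows "x \<le> max_eigenvalue A"
proof -
  have "finite {x. complex_of_real x \<in> eigenvalues A}"
    using finite_vimageI[OF finite_eigenvalues inj_of_real] by (simp add: vimage_def)
  then show ?thesis
    unfolding max_eigenvalue_def using assms by (intro Max_ge) auto
qed

lemma invertible_of_all_eigenvalues_positive:
  assumes "all_eigenvalues_positive A"
  shows "invertible (cmatrix A)"
proof -
  have "0 \<notin> eigenvalues A"
    using assms unfolding all_eigenvalues_positive_def by auto
  then show ?thesis
    using not_invertible_add_mat_iff[of A 0] by simp
qed

section \<open>Closed-loop algebra\<close>

lemma one_add_loop_gain:
  assumes "invertible (cmatrix Q)"
  shows "cmatrix Q ** (mat 1 + loop_gain Q L' s) = cmatrix Q + mat (L' s)"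
  by (simp add: loop_gain_def matrix_add_ldistrib matrix_mul_assoc matrix_inv_mult[OF assms])

lemma invertible_one_add_loop_gain_iff:
  assumes Q: "invertible (cmatrix Q)"
  shows "invertible (mat 1 + loop_gain Q L' s) \<longleftrightarrow> invertible (cmatrix Q + mat (L' s))"
  unfolding one_add_loop_gain[OF Q, symmetric] invertible_iff_ker matrix_vector_mul_assoc[symmetric]
  by (metis Q invertible_iff_ker matrix_vector_mult_0_right)

text \<open>Collecting the terms in \<open>f\<close> turns the feedback equation into
  \<open>(mat 1 + L s) *v f = L s *v g\<close>. This ties the formula \<open>closed_loop\<close> to
  the loop it is meant to solve.\<close>

lemma closed_loop_solves:
  fixes L :: "complex \<Rightarrow> complex^'n^'n"
  assumes "invertible (mat 1 + L s)"
  shows "f = - (L s *v (f - g)) \<longleftrightarrow> f = closed_loop L s *v g"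
proof -
  have "f = - (L s *v (f - g)) \<longleftrightarrow> (mat 1 + L s) *v f = L s *v g"
    by (auto simp: algebra_simps)
  then show ?thesis
    by (simp add: closed_loop_def matrix_inv_vector_eq_iff[OF assms] flip: matrix_vector_mul_assoc)
qed

text \<open>Multiplying (I + L) T = L by Q from the left cancels the inverse inside
  \<open>loop_gain\<close> and leaves (Q + L' I) T = L' I. The two matrices are compared through
  their action on vectors.\<close>

lemma closed_loop_loop_gain:
  assumes Q: "invertible (cmatrix Q)" and inv: "invertible (mat 1 + loop_gain Q L' s)"
  shows "closed_loop (loop_gain Q L') s = matrix_inv (cmatrix Q + mat (L' s)) ** mat (L' s)"
proof -
  let ?L = "loop_gain Q L' s"
  have X: "invertible (cmatrix Q + mat (L' s))"
    using inv invertible_one_add_loop_gain_iff[OF Q] by blast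
  have "closed_loop (loop_gain Q L') s *v g = (matrix_inv (cmatrix Q + mat (L' s)) ** mat (L' s)) *v g" for g
  proof -
    let ?f = "closed_loop (loop_gain Q L') s *v g"
    have "(mat 1 + ?L) *v ?f = ?L *v g"
      by (simp add: closed_loop_def matrix_vector_mul_assoc matrix_mul_assoc matrix_inv_mult[OF inv])
    then have "(cmatrix Q ** (mat 1 + ?L)) *v ?f = (cmatrix Q ** ?L) *v g"
      by (simp flip: matrix_vector_mul_assoc)
    then have "(cmatrix Q + mat (L' s)) *v ?f = mat (L' s) *v g"
      by (simp add: one_add_loop_gain[OF Q])
         (simp add: loop_gain_def matrix_mul_assoc matrix_inv_mult[OF Q])
    then show ?thesis
      using matrix_inv_vector_eq_iff[OF X] by (simp flip: matrix_vector_mul_assoc)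
  qed
  then show ?thesis
    by (simp add: matrix_eq)
qed

section \<open>The characteristic cubic and the poles\<close>

lemma loop_scalar_eq_iff:
  assumes "\<omega>_a \<noteq> 0" "s \<noteq> 0"
  shows "- loop_scalar G_v G_p \<omega>_a s = \<mu> \<longleftrightarrow>
    \<mu> / complex_of_real \<omega>_a * s ^ 3 + s ^ 2 + complex_of_real G_v * s + complex_of_real G_p = 0"
proof -
  have "- (a / b) = \<mu> \<longleftrightarrow> \<mu> * b + a = 0" if "b \<noteq> 0" for a b :: complex
    using that by (metis add_eq_0_iff divide_eq_eq eq_neg_iff_add_eq_0 minus_divide_left)
  from this[of "inverse (complex_of_real \<omega>_a) * s ^ 3"] show ?thesis
    using assms unfolding loop_scalar_def by (simp add: divide_inverse[of \<mu>] mult.assoc add.assoc)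
qed

lemma eigenvalue_loop_scalar_imp_Re_neg:
  assumes gains: "0 < G_v" "0 < G_p" "0 < \<omega>_a"
    and pos: "all_eigenvalues_positive Q"
    and bound: "max_eigenvalue Q * G_p < \<omega>_a * G_v"
    and ev: "- loop_scalar G_v G_p \<omega>_a s \<in> eigenvalues Q" and "s \<noteq> 0"
  shows "Re s < 0"
proof -
  have "- loop_scalar G_v G_p \<omega>_a s \<in> \<real>" "0 < Re (- loop_scalar G_v G_p \<omega>_a s)"
    using pos ev unfolding all_eigenvalues_positive_def by blast+
  then obtain \<mu> where \<mu>: "- loop_scalar G_v G_p \<omega>_a s = complex_of_real \<mu>" "0 < \<mu>"
    by (metis Re_complex_of_real Reals_cases)
  have "\<mu> * G_p \<le> max_eigenvalue Q * G_p"
    using eigenvalue_le_max_eigenvalue ev \<mu>(1) gains(2) by (intro mult_right_mono) auto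
  then have "\<mu> * G_p < \<omega>_a * G_v"
    using bound by (rule le_less_trans)
  \<comment> \<open>This is the condition \<open>a * c < b\<close> of \<open>cubic_hurwitz\<close>
    for the cubic belonging to \<mu>.\<close>
  then have "\<mu> / \<omega>_a * G_p < G_v"
    using gains by (simp add: field_simps)
  then show ?thesis
    using cubic_hurwitz[of "\<mu> / \<omega>_a" G_v G_p s] loop_scalar_eq_iff[of \<omega>_a s G_v G_p "of_real \<mu>"] \<mu> gains \<open>s \<noteq> 0\<close>
    by simp
qed

lemma finite_singular_loop:
  assumes "\<omega>_a \<noteq> 0"
  shows "finite {s. - loop_scalar G_v G_p \<omega>_a s \<in> eigenvalues Q}"
proof -
  let ?p = "\<lambda>\<mu>. [:complex_of_real G_p, complex_of_real G_v, 1, \<mu> / complex_of_real \<omega>_a:]"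
  \<comment> \<open>The origin is listed separately because the passage to the cubic divides by a
    power of \<open>s\<close>. The coefficient 1 of the quadratic term keeps each polynomial nonzero
    whatever \<mu> is, so its roots are finite in number.\<close>
  have "{s. - loop_scalar G_v G_p \<omega>_a s \<in> eigenvalues Q}
      \<subseteq> insert 0 (\<Union>\<mu>\<in>eigenvalues Q. {s. poly (?p \<mu>) s = 0})"
  proof
    fix s
    assume s: "s \<in> {s. - loop_scalar G_v G_p \<omega>_a s \<in> eigenvalues Q}"
    let ?\<mu> = "- loop_scalar G_v G_p \<omega>_a s"
    have "poly (?p \<mu>) s = \<mu> / complex_of_real \<omega>_a * s ^ 3 + s ^ 2
        + complex_of_real G_v * s + complex_of_real G_p" for \<mu>
      by (simp add: power2_eq_square power3_eq_cube algebra_simps)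
    then have "poly (?p ?\<mu>) s = 0" if "s \<noteq> 0"
      using loop_scalar_eq_iff[OF assms that] by metis
    then show "s \<in> insert 0 (\<Union>\<mu>\<in>eigenvalues Q. {s. poly (?p \<mu>) s = 0})"
      using s by blast
  qed
  moreover have "finite (insert 0 (\<Union>\<mu>\<in>eigenvalues Q. {s. poly (?p \<mu>) s = 0}))"
    by (intro finite.insertI finite_UN_I finite_eigenvalues poly_roots_finite) simp
  ultimately show ?thesis
    by (rule finite_subset)
qed

text \<open>With numerator p and denominator d of L', the matrix N = d Q + p I satisfies N T = p I
  away from the origin and the singular points. Cramer's rule then writes each entry of T as a
  quotient of determinants that is continuous at \<open>q\<close>, so the entry has a finite limit
  there. The eigenvalue condition is imposed only for \<open>q\<close> \<noteq> 0.\<close>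

lemma not_is_pole_closed_loop:
  assumes "G_p \<noteq> 0" "\<omega>_a \<noteq> 0" and Q: "invertible (cmatrix Q)"
    and q: "q \<noteq> 0 \<Longrightarrow> - loop_scalar G_v G_p \<omega>_a q \<notin> eigenvalues Q"
  shows "\<not> is_pole (\<lambda>s. closed_loop (loop_gain Q (loop_scalar G_v G_p \<omega>_a)) s $ k $ l) q"
proof -
  let ?L' = "loop_scalar G_v G_p \<omega>_a"
  let ?T = "closed_loop (loop_gain Q ?L')"
  define d where "d s = inverse (complex_of_real \<omega>_a) * s ^ 3" for s
  define p where "p s = s ^ 2 + complex_of_real G_v * s + complex_of_real G_p" for s :: complex
  define N where "N s = mat (d s) ** cmatrix Q + mat (p s)" for s
  \<comment> \<open>The numerator matrix of Cramer's rule for entry (k, l): column \<open>k\<close>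
    of \<open>N s\<close> is replaced by column \<open>l\<close> of
    \<open>mat (p s)\<close>.\<close>
  define R where "R s = (\<chi> i j. if j = k then (p s *s axis l 1) $ i else N s $ i $ j)" for s
  have L': "?L' s = p s / d s" for s
    by (simp add: loop_scalar_def p_def d_def)
  have d: "d s \<noteq> 0" if "s \<noteq> 0" for s
    using that \<open>\<omega>_a \<noteq> 0\<close> by (simp add: d_def)
  have Nd: "N s = mat (d s) ** (cmatrix Q + mat (?L' s))" if "s \<noteq> 0" for s
  proof -
    have "mat (d s) ** mat (p s / d s) = (mat (p s) :: complex^'a^'a)"
      using d[OF that] by (simp add: vec_eq_iff mat_mult_component) (simp add: mat_def)
    then show ?thesis by (simp add: N_def L' matrix_add_ldistrib)
  qed
  \<comment> \<open>At the origin \<open>d\<close> vanishes and \<open>N\<close> is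
    \<open>G_p\<close> times the identity, so invertibility there does not depend on the spectrum of
    \<open>Q\<close>.\<close>
  have N_inv: "invertible (N s)" if "s = 0 \<or> - ?L' s \<notin> eigenvalues Q" for s
  proof (cases "s = 0")
    case True
    then have "N s = mat (p s)" "p s \<noteq> 0"
      using \<open>G_p \<noteq> 0\<close> by (simp_all add: N_def d_def p_def)
    then show ?thesis by (simp add: invertible_iff_ker mat_vector_mult vec.scale_eq_0_iff)
  next
    case False
    then have "invertible (cmatrix Q + mat (?L' s))"
      using that not_invertible_add_mat_iff by blast
    moreover have "invertible (mat (d s) :: complex^'a^'a)"
      using d[OF False] by (simp add: invertible_iff_ker mat_vector_mult vec.scale_eq_0_iff)
    ultimately show ?thesis
      using Nd[OF False] invertible_mult by metis
  qed
  have T: "?T s $ k $ l = det (R s) / det (N s)" if "s \<noteq> 0" "- ?L' s \<notin> eigenvalues Q" for s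
  proof -
    have X: "invertible (cmatrix Q + mat (?L' s))"
      using that not_invertible_add_mat_iff by blast
    then have "?T s = matrix_inv (cmatrix Q + mat (?L' s)) ** mat (?L' s)"
      using closed_loop_loop_gain invertible_one_add_loop_gain_iff Q by blast
    then have "(cmatrix Q + mat (?L' s)) ** ?T s = mat (?L' s)"
      by (simp add: matrix_mul_assoc matrix_inv_mult[OF X])
    then have "N s ** ?T s = mat (d s) ** mat (?L' s)"
      by (simp add: Nd[OF that(1)] flip: matrix_mul_assoc)
    also have "\<dots> = mat (p s)"
      using d[OF that(1)] by (simp add: vec_eq_iff mat_mult_component L') (simp add: mat_def)
    \<comment> \<open>Applying both sides to a basis vector isolates column \<open>l\<close> of
      \<open>?T s\<close> as the solution of one linear system.\<close>
    finally have "N s *v (?T s *v axis l 1) = p s *s axis l 1"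
      by (simp add: matrix_vector_mul_assoc mat_vector_mult)
    moreover have "det (N s) \<noteq> 0"
      using N_inv that invertible_det_nz by blast
    ultimately have "?T s *v axis l 1 = (\<chi> k. det (\<chi> i j. if j = k then (p s *s axis l 1) $ i else N s $ i $ j) / det (N s))"
      using cramer by blast
    then have "(?T s *v axis l 1) $ k = det (R s) / det (N s)"
      by (simp add: R_def)
    then show ?thesis
      by (simp add: matrix_vector_mult_def axis_def if_distrib cong: if_cong)
  qed
  have contN: "isCont (\<lambda>s. N s $ i $ j) q" for i j
  proof -
    have "N s $ i $ j = d s * cmatrix Q $ i $ j + (if i = j then p s else 0)" for s
      by (simp add: N_def mat_mult_component) (simp add: mat_def)
    then show ?thesis
      unfolding d_def p_def by (cases "i = j") (auto intro!: continuous_intros)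
  qed
  have "isCont (\<lambda>s. R s $ i $ j) q" for i j
    by (cases "j = k") (auto simp: R_def p_def intro!: continuous_intros contN)
  moreover have "det (N q) \<noteq> 0"
    using N_inv q invertible_det_nz by blast
  ultimately have "isCont (\<lambda>s. det (R s) / det (N s)) q"
    by (intro isCont_divide isCont_det contN)
  then have lim: "(\<lambda>s. det (R s) / det (N s)) \<midarrow>q\<rightarrow> det (R q) / det (N q)"
    by (simp add: isCont_def)
  \<comment> \<open>The exceptional set of the quotient formula is finite. Without \<open>q\<close>
    it is closed and avoids \<open>q\<close>, so the formula holds on a punctured neighbourhood of
    \<open>q\<close>, even if \<open>q\<close> itself is exceptional.\<close>
  have "\<forall>\<^sub>F s in at q. s \<notin> insert 0 {s. - ?L' s \<in> eigenvalues Q} - {q}"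
  proof -
    have "closed (insert 0 {s. - ?L' s \<in> eigenvalues Q} - {q})"
      using finite_singular_loop[OF assms(2)] by (intro finite_imp_closed) simp
    from eventually_at_in_open'[OF open_Compl[OF this], of q] show ?thesis
      by (simp only: Compl_iff) simp
  qed
  moreover have "\<forall>\<^sub>F s in at q. s \<noteq> q"
    by (simp add: eventually_at_filter)
  ultimately have "\<forall>\<^sub>F s in at q. det (R s) / det (N s) = ?T s $ k $ l"
    by eventually_elim (simp add: T)
  with lim have "(\<lambda>s. ?T s $ k $ l) \<midarrow>q\<rightarrow> det (R q) / det (N q)"
    by (rule Lim_transform_eventually)
  then show ?thesis
    using not_tendsto_and_filterlim_at_infinity[OF at_neq_bot] unfolding is_pole_def by blast
qed

theorem proposition2:
  fixes M_r M_s Q :: "real^'n^'n"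
    and G_v G_p \<omega>_p \<omega>_a :: real
    and L' :: "complex \<Rightarrow> complex"
    and L T :: "complex \<Rightarrow> complex^'n^'n"
  assumes M_r: "sym_pos_def M_r" and M_s: "sym_pos_def M_s"
    and Q: "Q = M_s ** matrix_inv M_r"
    and gains: "0 < G_v" "0 < G_p"
    and \<omega>_p: "\<omega>_p = 2 * G_p / G_v"
    and \<omega>_a: "0 < \<omega>_a"
    and L': "L' = loop_scalar G_v G_p \<omega>_a"
    and L: "L = loop_gain Q L'"
    and T: "T = closed_loop L"
    and Q_pos: "all_eigenvalues_positive Q"
    and Q_max: "max_eigenvalue Q < 2 * \<omega>_a / \<omega>_p"
  shows "finite {s. \<not> invertible (mat 1 + L s)} \<and>
    (\<forall>s. s \<noteq> 0 \<and> invertible (mat 1 + L s) \<longrightarrow>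
      (\<forall>f_a lam. f_a = - (L s *v (f_a - lam)) \<longleftrightarrow> f_a = T s *v lam) \<and>
      T s = matrix_inv (cmatrix Q + mat (L' s)) ** mat (L' s)) \<and>
    stable_transfer T"
proof -
  have Q_inv: "invertible (cmatrix Q)"
    by (rule invertible_of_all_eigenvalues_positive[OF Q_pos])
  \<comment> \<open>Inserting the value of \<open>\<omega>_p\<close> turns the right-hand side of
    \<open>Q_max\<close> into \<open>\<omega>_a * G_v / G_p\<close>.\<close>
  have bound: "max_eigenvalue Q * G_p < \<omega>_a * G_v"
    using Q_max gains by (simp add: \<omega>_p field_simps)
  have "{s. \<not> invertible (mat 1 + L s)} = {s. - loop_scalar G_v G_p \<omega>_a s \<in> eigenvalues Q}"
    by (simp add: L L' invertible_one_add_loop_gain_iff[OF Q_inv] not_invertible_add_mat_iff)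
  then have "finite {s. \<not> invertible (mat 1 + L s)}"
    using finite_singular_loop[of \<omega>_a G_v G_p Q] \<omega>_a by simp
  moreover have "f_a = - (L s *v (f_a - lam)) \<longleftrightarrow> f_a = T s *v lam"
    if "invertible (mat 1 + L s)" for s f_a lam
    using that unfolding T by (rule closed_loop_solves)
  moreover have "T s = matrix_inv (cmatrix Q + mat (L' s)) ** mat (L' s)"
    if "invertible (mat 1 + L s)" for s
    using that unfolding T L by (rule closed_loop_loop_gain[OF Q_inv])
  moreover have "stable_transfer T"
    unfolding stable_transfer_def
  proof (rule ballI, rule ccontr)
    fix q
    assume "q \<in> poles T" and q: "\<not> Re q < 0"
    then obtain i j where pole: "is_pole (\<lambda>s. T s $ i $ j) q"
      unfolding poles_def by blast
    \<comment> \<open>A nonzero \<open>q\<close> in the closed right half-plane cannot be a root of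
      any of the cubics. The remaining candidate \<open>q = 0\<close> is covered by
      \<open>not_is_pole_closed_loop\<close> directly.\<close>
    have "- loop_scalar G_v G_p \<omega>_a q \<notin> eigenvalues Q" if "q \<noteq> 0"
      using eigenvalue_loop_scalar_imp_Re_neg[OF gains \<omega>_a Q_pos bound] that q by blast
    then show False
      using not_is_pole_closed_loop[OF _ _ Q_inv, of G_p \<omega>_a q G_v i j] pole gains \<omega>_a
      by (simp add: T L L')
  qed
  ultimately show ?thesis by blast
qed

end
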